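(* Let $N\ge 1$ be an integer, $p>1$ and $1<q<\frac{2p}{p+1}$. There exists a constant $c_{N,p,q}>0$, depending only on $N,p,q$, such that for any $M>0$ the following holds: if $u$ is a nonnegative solution of $$u_t-\Delta u=u^p+M|\nabla u|^q\quad\text{in }\mathbb{R}^N\times(-\infty,0)$$ satisfying $$u\le c_{N,p,q}\,M^{\frac{2}{2p-(p+1)q}}\quad\text{and}\quad u_t\le 0\quad\text{in }\mathbb{R}^N\times(-\infty,0),$$ then $u\equiv 0$.
   Context: The operators $\nabla$ and $\Delta$ act only on the spatial variable $x$. A solution is a classical solution, i.e. it belongs to $C^{2,1}(\mathbb{R}^N\times(-\infty,0))$ ($C^2$ in $x$, $C^1$ in $t$). *)

theory Defs
  imports "HOL-Analysis.Analysis"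
begin

definition partial_x :: "'n \<Rightarrow> (real ^ 'n \<Rightarrow> real) \<Rightarrow> real ^ 'n \<Rightarrow> real" where
  "partial_x i f x = deriv (\<lambda>s. f (x + s *\<^sub>R axis i 1)) 0"

definition has_partial_x :: "'n \<Rightarrow> (real ^ 'n \<Rightarrow> real) \<Rightarrow> real ^ 'n \<Rightarrow> bool" where
  "has_partial_x i f x \<longleftrightarrow> (\<lambda>s::real. f (x + s *\<^sub>R axis i 1)) differentiable (at 0)"

definition gradient :: "(real ^ 'n \<Rightarrow> real) \<Rightarrow> real ^ 'n \<Rightarrow> real ^ 'n" where
  "gradient f x = (\<chi> i. partial_x i f x)"

definition laplacian :: "(real ^ 'n \<Rightarrow> real) \<Rightarrow> real ^ 'n \<Rightarrow> real" where
  "laplacian f x = (\<Sum>i\<in>UNIV. partial_x i (partial_x i f) x)"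

definition time_deriv :: "(real ^ 'n \<Rightarrow> real \<Rightarrow> real) \<Rightarrow> real ^ 'n \<Rightarrow> real \<Rightarrow> real" where
  "time_deriv u x t = deriv (u x) t"

text \<open>The space $C^{2,1}$ over all of space and negative times: the partial derivatives of order
  at most two in space and of order one in time exist and, like the function itself, are jointly
  continuous in $(x,t)$. Functions are total, so their values at $t \ge 0$ are irrelevant.\<close>

definition C21_ancient :: "(real ^ 'n \<Rightarrow> real \<Rightarrow> real) \<Rightarrow> bool" where
  "C21_ancient u \<longleftrightarrow>
     continuous_on (UNIV \<times> {..<0}) (\<lambda>(x, t). u x t) \<and>
     (\<forall>x. \<forall>t<0. u x differentiable (at t)) \<and>
     continuous_on (UNIV \<times> {..<0}) (\<lambda>(x, t). time_deriv u x t) \<and>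
     (\<forall>i x. \<forall>t<0. has_partial_x i (\<lambda>y. u y t) x) \<and>
     (\<forall>i. continuous_on (UNIV \<times> {..<0}) (\<lambda>(x, t). partial_x i (\<lambda>y. u y t) x)) \<and>
     (\<forall>i j x. \<forall>t<0. has_partial_x i (partial_x j (\<lambda>y. u y t)) x) \<and>
     (\<forall>i j. continuous_on (UNIV \<times> {..<0})
              (\<lambda>(x, t). partial_x i (partial_x j (\<lambda>y. u y t)) x))"

definition nonneg_ancient_solution ::
    "real \<Rightarrow> real \<Rightarrow> real \<Rightarrow> (real ^ 'n \<Rightarrow> real \<Rightarrow> real) \<Rightarrow> bool" where
  "nonneg_ancient_solution p q M u \<longleftrightarrow>
     C21_ancient u \<and>
     (\<forall>x. \<forall>t<0. u x t \<ge> 0) \<and>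
     (\<forall>x. \<forall>t<0. time_deriv u x t - laplacian (\<lambda>y. u y t) x
                  = u x t powr p + M * norm (gradient (\<lambda>y. u y t) x) powr q)"

end

theory Submission
  imports Defs
begin

text \<open>
  Bernstein's method for $z = |\nabla u|^2$. Since $u_t \le 0$, the equation gives
  $|D^2u|^2 \ge (\Delta u)^2/N \ge (u^{2p} + M^2 z^q)/N$, and for small $u$ this absorbs the bad term
  $p u^{p-1} z$ of the equation for $z$. What remains is a superlinear absorption $z^q$, which
  bounds $z$ at $(x_0,t_0)$ by a negative power of $R$ when $\eta^m z$ is maximised over a backward
  paraboloid of size $R$; letting $R \to \infty$ gives $\nabla u = 0$, so $u^p = u_t \le 0$.
  As $u$ is only $C^{2,1}$, the equation for $z$ is not available. Instead $\nabla u$ is replaced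
  by difference quotients with step $h$, which are again $C^{2,1}$, and $h \to 0$ is taken only in the
  optimality conditions at the maximum points, where second derivatives of $u$ suffice.
\<close>

section \<open>Optimality conditions at a maximum in one real variable\<close>

text \<open>If \<open>g2\<close> were positive, then \<open>g'\<close>, which vanishes at 0, would
  be positive just to the right of 0, and the mean value theorem would lift \<open>g\<close> above
  \<open>g 0\<close> there. Only the derivative of \<open>g'\<close> at 0 itself enters.\<close>

lemma second_derivative_local_max:
  fixes g g' :: "real \<Rightarrow> real"
  assumes "d > 0"
    and g: "\<And>s. \<bar>s\<bar> < d \<Longrightarrow> (g has_real_derivative g' s) (at s)"
    and g': "(g' has_real_derivative g2) (at 0)"
    and mx: "\<And>s. \<bar>s\<bar> < d \<Longrightarrow> g s \<le> g 0"
  shows "g' 0 = 0" and "g2 \<le> 0"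
proof -
  show 0: "g' 0 = 0"
    by (rule DERIV_local_max[OF g \<open>d > 0\<close>]) (use mx \<open>d > 0\<close> in auto)
  show "g2 \<le> 0"
  proof (rule ccontr)
    assume "\<not> g2 \<le> 0"
    then obtain e where e: "e > 0" "\<And>h. 0 < h \<Longrightarrow> h < e \<Longrightarrow> g' 0 < g' h"
      using DERIV_pos_inc_right[OF g'] by auto
    define s where "s = min d e / 2"
    have s: "0 < s" "s < d" "s < e" using e \<open>d > 0\<close> by (auto simp: s_def min_def)
    obtain \<xi> where \<xi>: "0 < \<xi>" "\<xi> < s" "g s - g 0 = (s - 0) * g' \<xi>"
      using MVT2[of 0 s g g'] g s by auto
    have "g' \<xi> > 0" using e(2)[of \<xi>] \<xi> s 0 by auto
    then have "g s > g 0" using \<xi> s by (smt (verit) mult_pos_pos)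
    with mx[of s] s show False by auto
  qed
qed

text \<open>The cross term $e'z'$ of the second-order condition is eliminated by the first-order one.\<close>

lemma weighted_local_max:
  fixes e z e' z' :: "real \<Rightarrow> real"
  assumes "d > 0"
    and e: "\<And>s. (e has_real_derivative e' s) (at s)" and e': "(e' has_real_derivative e2) (at 0)"
    and z: "\<And>s. (z has_real_derivative z' s) (at s)" and z': "(z' has_real_derivative z2) (at 0)"
    and pos: "\<And>s. \<bar>s\<bar> < d \<Longrightarrow> e s > 0" "\<And>s. \<bar>s\<bar> < d \<Longrightarrow> z s > 0"
    and mx: "\<And>s. \<bar>s\<bar> < d \<Longrightarrow> e s ^ m * z s \<le> e 0 ^ m * z 0"
  shows "e 0 * z' 0 = - real m * e' 0 * z 0"
    and "(e 0)\<^sup>2 * z2 \<le> z 0 * (((real m)\<^sup>2 + real m) * (e' 0)\<^sup>2 - real m * e 0 * e2)"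
proof -
  \<comment> \<open>The logarithm turns the weighted product into a sum whose derivatives are
    immediate.\<close>
  define g where "g s = real m * ln (e s) + ln (z s)" for s
  define g' where "g' s = real m * (e' s / e s) + z' s / z s" for s
  have g: "(g has_real_derivative g' s) (at s)" if "\<bar>s\<bar> < d" for s
    unfolding g_def g'_def using pos[OF that]
    by (auto intro!: derivative_eq_intros e z)
  have p0: "e 0 > 0" "z 0 > 0" using pos \<open>d > 0\<close> by auto
  have dg': "(g' has_real_derivative (real m * ((e2 * e 0 - e' 0 * e' 0) / (e 0 * e 0))
      + (z2 * z 0 - z' 0 * z' 0) / (z 0 * z 0))) (at 0)"
    unfolding g'_def using p0
    by (intro DERIV_add DERIV_cmult DERIV_divide e z e' z') auto
  have gm: "g s = ln (e s ^ m * z s)" if "\<bar>s\<bar> < d" for s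
    using pos[OF that] by (simp add: g_def ln_mult ln_realpow)
  have "g s \<le> g 0" if "\<bar>s\<bar> < d" for s
    using mx[OF that] pos[OF that] p0 \<open>d > 0\<close> that by (simp add: gm)
  note * = second_derivative_local_max[OF \<open>d > 0\<close> g dg' this]
  show first: "e 0 * z' 0 = - real m * e' 0 * z 0"
    using *(1) p0 by (simp add: g'_def field_simps)
  have "(z 0)\<^sup>2 * (e 0)\<^sup>2 * (real m * ((e2 * e 0 - e' 0 * e' 0) / (e 0 * e 0))
      + (z2 * z 0 - z' 0 * z' 0) / (z 0 * z 0)) \<le> 0"
    using *(2) p0 by (intro mult_nonneg_nonpos) auto
  \<comment> \<open>The last square is rewritten by \<open>first\<close> as m^2 e'^2 z^2; together
    with the m e'^2 of the first term this produces the factor m^2 + m.\<close>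
  moreover have "(z 0)\<^sup>2 * (e 0)\<^sup>2 * (real m * ((e2 * e 0 - e' 0 * e' 0) / (e 0 * e 0))
      + (z2 * z 0 - z' 0 * z' 0) / (z 0 * z 0))
     = (z 0)\<^sup>2 * real m * (e2 * e 0 - (e' 0)\<^sup>2) + (e 0)\<^sup>2 * z2 * z 0 - (e 0 * z' 0)\<^sup>2"
    using p0 by (simp add: field_simps power2_eq_square)
  ultimately have "z 0 * ((e 0)\<^sup>2 * z2) \<le> z 0 * (z 0 * (((real m)\<^sup>2 + real m) * (e' 0)\<^sup>2 - real m * e 0 * e2))"
    unfolding first by (simp add: algebra_simps power2_eq_square)
  then show "(e 0)\<^sup>2 * z2 \<le> z 0 * (((real m)\<^sup>2 + real m) * (e' 0)\<^sup>2 - real m * e 0 * e2)"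
    using p0 by simp
qed

text \<open>In time only earlier points are available for comparison, because the domain ends at
  \<open>t0\<close>. The logarithmic derivative therefore has a sign instead of vanishing, and
  multiplying it by \<open>e t * z t\<close> gives the claim.\<close>

lemma weighted_left_max:
  fixes e z :: "real \<Rightarrow> real"
  assumes "d > 0"
    and e: "(e has_real_derivative e') (at t)" and z: "(z has_real_derivative z') (at t)"
    and pos: "\<And>s. t - d < s \<Longrightarrow> s \<le> t \<Longrightarrow> e s > 0" "\<And>s. t - d < s \<Longrightarrow> s \<le> t \<Longrightarrow> z s > 0"
    and mx: "\<And>s. t - d < s \<Longrightarrow> s \<le> t \<Longrightarrow> e s ^ m * z s \<le> e t ^ m * z t"
  shows "- real m * e' * z t \<le> e t * z'"
proof -
  define g where "g s = real m * ln (e s) + ln (z s)" for s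
  have p0: "e t > 0" "z t > 0" using pos \<open>d > 0\<close> by auto
  have g: "(g has_real_derivative real m * (e' / e t) + z' / z t) (at t)"
    unfolding g_def using p0 by (auto intro!: derivative_eq_intros e z)
  have gm: "g s = ln (e s ^ m * z s)" if "t - d < s" "s \<le> t" for s
    using pos[OF that] by (simp add: g_def ln_mult ln_realpow)
  have le: "g s \<le> g t" if "t - d < s" "s \<le> t" for s
    using mx[OF that] pos[OF that] p0 \<open>d > 0\<close> that by (simp add: gm)
  have "real m * (e' / e t) + z' / z t \<ge> 0"
  proof (rule ccontr)
    assume "\<not> ?thesis"
    then obtain k where k: "k > 0" "\<And>h. 0 < h \<Longrightarrow> h < k \<Longrightarrow> g t < g (t - h)"
      using DERIV_neg_dec_left[OF g] by auto
    define h where "h = min d k / 2"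
    have "0 < h" "h < d" "h < k" using k \<open>d > 0\<close> by (auto simp: h_def min_def)
    then show False using k(2)[of h] le[of "t - h"] by auto
  qed
  then have "0 \<le> e t * z t * (real m * (e' / e t) + z' / z t)" using p0 by simp
  also have "\<dots> = real m * e' * z t + e t * z'" using p0 by (simp add: field_simps)
  finally show ?thesis by simp
qed

section \<open>Difference quotients and their limits\<close>

lemma has_partial_x_has_derivative:
  assumes "\<And>x. has_partial_x i f x"
  shows "((\<lambda>s. f (x + s *\<^sub>R axis i 1)) has_real_derivative partial_x i f (x + s *\<^sub>R axis i 1)) (at s)"
proof -
  have "((\<lambda>r. f (x + s *\<^sub>R axis i 1 + r *\<^sub>R axis i 1)) has_real_derivative
      partial_x i f (x + s *\<^sub>R axis i 1)) (at 0)"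
    using assms[of "x + s *\<^sub>R axis i 1"] unfolding has_partial_x_def partial_x_def
    by (simp add: DERIV_deriv_iff_real_differentiable)
  then have "((\<lambda>r. f (x + (r + s) *\<^sub>R axis i 1)) has_real_derivative
      partial_x i f (x + s *\<^sub>R axis i 1)) (at 0)"
    by (simp add: scaleR_left_distrib add_ac)
  then show ?thesis
    using DERIV_shift[of "\<lambda>s. f (x + s *\<^sub>R axis i 1)" _ 0 s] by simp
qed

definition diff_quot :: "'n \<Rightarrow> real \<Rightarrow> (real ^ 'n \<Rightarrow> real) \<Rightarrow> real ^ 'n \<Rightarrow> real" where
  "diff_quot i h f x = (f (x + h *\<^sub>R axis i 1) - f x) / h"

text \<open>Translations along two axes commute, so differentiating a difference quotient in
  direction \<open>j\<close> costs one derivative of \<open>f\<close>. Two spatial derivatives of a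
  difference quotient of \<open>u\<close> thus involve only second derivatives of
  \<open>u\<close>.\<close>

lemma diff_quot_has_derivative:
  assumes "\<And>x. has_partial_x j f x"
  shows "((\<lambda>s. diff_quot i h f (x + s *\<^sub>R axis j 1)) has_real_derivative
            diff_quot i h (partial_x j f) (x + s *\<^sub>R axis j 1)) (at s)"
proof -
  have comm: "x + s *\<^sub>R axis j 1 + h *\<^sub>R axis i 1 = (x + h *\<^sub>R axis i 1) + s *\<^sub>R axis j 1" for s
    by simp
  show ?thesis
    unfolding diff_quot_def comm
    by (intro DERIV_cdivide DERIV_diff has_partial_x_has_derivative assms)
qed

text \<open>The mean value theorem replaces each quotient by a partial derivative at a nearby point,
  and joint continuity does the rest. Base point and time move with \<open>n\<close>, because the
  maximum points will depend on the step.\<close>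

lemma diff_quot_tendsto:
  fixes g :: "real ^ 'n \<Rightarrow> real \<Rightarrow> real"
  assumes part: "\<And>x t. t < 0 \<Longrightarrow> has_partial_x i (\<lambda>y. g y t) x"
    and cont: "continuous_on (UNIV \<times> {..<0}) (\<lambda>(x, t). partial_x i (\<lambda>y. g y t) x)"
    and h: "\<And>n. h n > 0" "h \<longlonglongrightarrow> 0"
    and x: "xs \<longlonglongrightarrow> x" and t: "ts \<longlonglongrightarrow> t" "t < 0" "\<And>n. ts n < 0"
  shows "(\<lambda>n. diff_quot i (h n) (\<lambda>y. g y (ts n)) (xs n)) \<longlonglongrightarrow> partial_x i (\<lambda>y. g y t) x"
proof -
  have "\<exists>\<theta>. 0 < \<theta> \<and> \<theta> < h n \<and> diff_quot i (h n) (\<lambda>y. g y (ts n)) (xs n)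
          = partial_x i (\<lambda>y. g y (ts n)) (xs n + \<theta> *\<^sub>R axis i 1)" for n
  proof -
    obtain \<theta> where "0 < \<theta>" "\<theta> < h n" "g (xs n + h n *\<^sub>R axis i 1) (ts n) - g (xs n + 0 *\<^sub>R axis i 1) (ts n)
        = (h n - 0) * partial_x i (\<lambda>y. g y (ts n)) (xs n + \<theta> *\<^sub>R axis i 1)"
      using MVT2[OF h(1)[of n] has_partial_x_has_derivative[OF part[OF t(3)[of n]], of "xs n"]] by blast
    then show ?thesis using h(1)[of n] by (auto simp: diff_quot_def field_simps)
  qed
  then obtain \<theta> where \<theta>: "\<And>n. 0 < \<theta> n" "\<And>n. \<theta> n < h n"
    "\<And>n. diff_quot i (h n) (\<lambda>y. g y (ts n)) (xs n)
          = partial_x i (\<lambda>y. g y (ts n)) (xs n + \<theta> n *\<^sub>R axis i 1)" by metis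
  have "\<theta> \<longlonglongrightarrow> 0"
    by (rule tendsto_sandwich[OF _ _ tendsto_const h(2)]) (simp_all add: less_imp_le \<theta>)
  then have "(\<lambda>n. (xs n + \<theta> n *\<^sub>R axis i 1, ts n)) \<longlonglongrightarrow> (x + 0 *\<^sub>R axis i 1, t)"
    by (intro tendsto_intros x t)
  then have "(\<lambda>n. (\<lambda>(x, t). partial_x i (\<lambda>y. g y t) x) (xs n + \<theta> n *\<^sub>R axis i 1, ts n))
      \<longlonglongrightarrow> (\<lambda>(x, t). partial_x i (\<lambda>y. g y t) x) (x, t)"
    using t by (intro continuous_on_tendsto_compose[OF cont]) auto
  then show ?thesis by (simp add: \<theta>(3))
qed

text \<open>A chain rule along two moving sequences: the intermediate points of the mean value
  theorem are squeezed to \<open>c\<close>, and \<open>c > 0\<close> keeps them away from the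
  possible singularity of the power at 0.\<close>

lemma powr_diff_quot_tendsto:
  fixes a b h :: "nat \<Rightarrow> real"
  assumes a: "a \<longlonglongrightarrow> c" and b: "b \<longlonglongrightarrow> c" and "c > 0"
    and ab: "(\<lambda>n. (b n - a n) / h n) \<longlonglongrightarrow> d"
  shows "(\<lambda>n. (b n powr r - a n powr r) / h n) \<longlonglongrightarrow> r * c powr (r - 1) * d"
proof -
  have ex: "\<exists>\<xi>. min x y \<le> \<xi> \<and> \<xi> \<le> max x y \<and> y powr r - x powr r = r * \<xi> powr (r - 1) * (y - x)"
    if "x > 0" "y > 0" for x y :: real
  proof -
    have D: "((\<lambda>s. s powr r) has_real_derivative r * s powr (r - 1)) (at s)" if "s > 0" for s
      using that by (rule has_real_derivative_powr)
    have mvt: "\<exists>\<xi>. a \<le> \<xi> \<and> \<xi> \<le> b \<and> b powr r - a powr r = r * \<xi> powr (r - 1) * (b - a)"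
      if "0 < a" "a < b" for a b :: real
    proof -
      have "((\<lambda>s. s powr r) has_real_derivative r * s powr (r - 1)) (at s)" if "a \<le> s" for s
        using D[of s] that \<open>0 < a\<close> by simp
      from MVT2[OF \<open>a < b\<close> this] obtain \<xi>
        where "a < \<xi>" "\<xi> < b" "b powr r - a powr r = (b - a) * (r * \<xi> powr (r - 1))" by blast
      then show ?thesis by (intro exI[of _ \<xi>]) (simp add: mult.commute)
    qed
    consider "x < y" | "x = y" | "y < x" by linarith
    then show ?thesis
    proof cases
      case 1
      with mvt[of x y] that show ?thesis by simp
    next
      case 3
      with mvt[of y x] that obtain \<xi>
        where "y \<le> \<xi>" "\<xi> \<le> x" "x powr r - y powr r = r * \<xi> powr (r - 1) * (x - y)" by blast
      then show ?thesis by (intro exI[of _ \<xi>]) (auto simp: algebra_simps)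
    qed auto
  qed
  \<comment> \<open>The intermediate point is guaranteed only once both terms are positive, which
    holds eventually; for the other \<open>n\<close> the choice is arbitrary.\<close>
  define \<xi> where "\<xi> n = (SOME \<xi>. min (a n) (b n) \<le> \<xi> \<and> \<xi> \<le> max (a n) (b n) \<and>
      b n powr r - a n powr r = r * \<xi> powr (r - 1) * (b n - a n))" for n
  have "eventually (\<lambda>n. a n > 0) sequentially" "eventually (\<lambda>n. b n > 0) sequentially"
    using a b \<open>c > 0\<close> by (auto dest: order_tendstoD)
  then have ev: "eventually (\<lambda>n. min (a n) (b n) \<le> \<xi> n \<and> \<xi> n \<le> max (a n) (b n) \<and>
      b n powr r - a n powr r = r * \<xi> n powr (r - 1) * (b n - a n)) sequentially"
    by eventually_elim (unfold \<xi>_def, rule someI_ex, rule ex, auto)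
  have "\<xi> \<longlonglongrightarrow> c"
  proof (rule tendsto_sandwich)
    show "(\<lambda>n. min (a n) (b n)) \<longlonglongrightarrow> c" using tendsto_min[OF a b] by simp
    show "(\<lambda>n. max (a n) (b n)) \<longlonglongrightarrow> c" using tendsto_max[OF a b] by simp
  qed (use ev in \<open>auto elim: eventually_mono\<close>)
  then have "(\<lambda>n. r * \<xi> n powr (r - 1) * ((b n - a n) / h n)) \<longlonglongrightarrow> r * c powr (r - 1) * d"
    using \<open>c > 0\<close> by (intro tendsto_intros ab) auto
  then show ?thesis
    by (rule Lim_transform_eventually) (use ev in eventually_elim, auto)
qed

section \<open>Scalar inequalities behind the absorption\<close>

text \<open>If $M^2z^q$ alone does not dominate, $z$ is bounded by a power of $s$, and the left-hand side by
  $s^{(p-1)q/(q-1)}$; this exponent exceeds $2p$ exactly when $q < 2p/(p+1)$.\<close>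

lemma reaction_absorption:
  fixes p q N M s z :: real
  assumes "p > 1" "1 < q" "q < 2 * p / (p + 1)" "N > 0" "M > 0" "s > 0" "z > 0"
    and small: "s \<le> (2 * N * p) powr (- q / (2 * p - (p + 1) * q)) * M powr (2 / (2 * p - (p + 1) * q))"
  shows "2 * N * p * s powr (p - 1) * z \<le> s powr (2 * p) + M\<^sup>2 * z powr q"
proof (cases "2 * N * p * s powr (p - 1) * z \<le> M\<^sup>2 * z powr q")
  case True
  then show ?thesis using powr_ge_zero[of s "2 * p"] by linarith
next
  case False
  define d where "d = 2 * p - (p + 1) * q"
  have d: "d > 0" using assms by (simp add: d_def field_simps)
  define k where "k = 2 * N * p"
  have k: "k > 0" using assms by (simp add: k_def)
  have "ln (M\<^sup>2 * z powr q) < ln (k * s powr (p - 1) * z)"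
    using False assms k unfolding k_def by (intro ln_less_cancel_iff[THEN iffD2]) auto
  then have 1: "(q - 1) * ln z < ln k + (p - 1) * ln s - 2 * ln M"
    using assms k by (simp add: ln_mult ln_powr ln_realpow algebra_simps)
  have "ln s \<le> ln (k powr (- q / d) * M powr (2 / d))"
    using small assms k by (subst ln_le_cancel_iff) (auto simp: k_def d_def)
  then have "ln s \<le> - q / d * ln k + 2 / d * ln M"
    using assms k by (simp add: ln_mult ln_powr)
  then have "d * ln s \<le> d * (- q / d * ln k + 2 / d * ln M)"
    using d by (intro mult_left_mono) auto
  also have "\<dots> = - q * ln k + 2 * ln M" using d by (simp add: field_simps)
  finally have 2: "d * ln s \<le> - q * ln k + 2 * ln M" .
  \<comment> \<open>Eliminating ln z by 1 leaves exactly inequality 2, since 2p(q - 1) - q(p - 1) =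
    -d. This is where the threshold with exponents -q/d and 2/d comes from.\<close>
  have "(q - 1) * (ln k + (p - 1) * ln s + ln z) \<le> (q - 1) * (2 * p * ln s)"
    using 1 2 unfolding d_def by (simp add: algebra_simps)
  then have "ln k + (p - 1) * ln s + ln z \<le> 2 * p * ln s" using assms by simp
  then have "ln (k * s powr (p - 1) * z) \<le> ln (s powr (2 * p))"
    using assms k by (simp add: ln_mult ln_powr)
  then have "k * s powr (p - 1) * z \<le> s powr (2 * p)"
    using assms k by (subst (asm) ln_le_cancel_iff) auto
  then show ?thesis using \<open>M > 0\<close> unfolding k_def
    by (smt (verit) powr_ge_zero mult_nonneg_nonneg zero_le_power2)
qed

text \<open>Beyond the claimed bound X exceeds 1, so a X + b <= (a + b) X < X^2.\<close>

lemma quadratic_bound: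
  fixes X a b :: real
  assumes "X\<^sup>2 \<le> a * X + b" "a \<ge> 0" "b \<ge> 0"
  shows "X \<le> a + b + 1"
proof (rule ccontr)
  assume *: "\<not> ?thesis"
  then have "X > 1" using assms by auto
  have "(a + b) * X < X * X" using * \<open>X > 1\<close> by (intro mult_strict_right_mono) auto
  moreover have "b \<le> b * X" using \<open>X > 1\<close> assms(3) by (simp add: mult_le_cancel_left1)
  ultimately show False using assms(1) by (simp add: power2_eq_square algebra_simps)
qed

section \<open>The paraboloid cutoff\<close>

text \<open>For times up to \<open>t0\<close> it is nonnegative exactly on a solid backward
  paraboloid with top centre (x0, t0), where its value is 1. Being polynomial, it has explicit
  derivatives; on the paraboloid the time derivative, the second derivatives and the squared
  gradient are all of order 1/R^2.\<close>

definition cutoff :: "real \<Rightarrow> real ^ 'n \<Rightarrow> real \<Rightarrow> real ^ 'n \<Rightarrow> real \<Rightarrow> real" where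
  "cutoff R x0 t0 x t = 1 - (norm (x - x0))\<^sup>2 / R\<^sup>2 - (t0 - t) / R\<^sup>2"

lemma cutoff_space_derivative:
  fixes x :: "real ^ 'n"
  shows "((\<lambda>s. cutoff R x0 t0 (x + s *\<^sub>R axis j 1) t) has_real_derivative - (2 * ((x - x0) $ j + s) / R\<^sup>2)) (at s)"
proof -
  have "(norm (x + s *\<^sub>R axis j 1 - x0))\<^sup>2 = (norm (x - x0))\<^sup>2 + 2 * s * (x - x0) $ j + s\<^sup>2" for s
  proof -
    have "(norm (v + s *\<^sub>R axis j 1))\<^sup>2 = (norm v)\<^sup>2 + 2 * s * v $ j + s\<^sup>2" for v :: "real ^ 'n"
      unfolding power2_norm_eq_inner
      by (simp add: inner_add_left inner_add_right inner_axis inner_axis' inner_axis_axis power2_eq_square distrib_left)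
    from this[of "x - x0"] show ?thesis by (simp add: algebra_simps)
  qed
  note * = this
  show ?thesis
    unfolding cutoff_def divide_inverse * by (auto intro!: derivative_eq_intros simp: algebra_simps)
qed

lemma cutoff_nonneg_iff:
  "R > 0 \<Longrightarrow> 0 \<le> cutoff R x0 t0 x t \<longleftrightarrow> (norm (x - x0))\<^sup>2 + (t0 - t) \<le> R\<^sup>2"
  by (simp add: cutoff_def diff_diff_eq add_divide_distrib[symmetric])

lemma cutoff_le_one: "t \<le> t0 \<Longrightarrow> cutoff R x0 t0 x t \<le> 1"
  unfolding cutoff_def by (smt (verit) divide_nonneg_nonneg zero_le_power2)

lemma cutoff_time_derivative: "((\<lambda>t. cutoff R x0 t0 x t) has_real_derivative 1 / R\<^sup>2) (at t)"
  unfolding cutoff_def divide_inverse by (auto intro!: derivative_eq_intros)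

lemma continuous_on_cutoff: "continuous_on S (\<lambda>(x, t). cutoff R x0 t0 x t)"
  unfolding cutoff_def case_prod_unfold divide_inverse by (intro continuous_intros)

lemma compact_cutoff_domain:
  fixes x0 :: "real ^ 'n"
  assumes "R > 0"
  shows "compact {(x, t). t \<le> t0 \<and> 0 \<le> cutoff R x0 t0 x t}" (is "compact ?K")
proof -
  have "?K = UNIV \<times> {..t0} \<inter> (\<lambda>(x, t). cutoff R x0 t0 x t) -` {0..}" by auto
  moreover have "closed (UNIV \<times> {..t0} \<inter> (\<lambda>(x, t). cutoff R x0 t0 x t) -` {0..})"
    by (intro continuous_closed_preimage continuous_on_cutoff closed_Times) auto
  ultimately have "closed ?K" by simp
  moreover have "?K \<subseteq> cball x0 R \<times> {t0 - R\<^sup>2..t0}"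
  proof safe
    fix x t assume t: "t \<le> t0" and c: "0 \<le> cutoff R x0 t0 x t"
    have "(norm (x - x0))\<^sup>2 + (t0 - t) \<le> R\<^sup>2"
      using c assms by (simp add: cutoff_nonneg_iff)
    then have "(norm (x - x0))\<^sup>2 \<le> R\<^sup>2" "t \<ge> t0 - R\<^sup>2"
      using t by (auto intro: order_trans[rotated]) (smt (verit) zero_le_power2)
    then show "x \<in> cball x0 R" "t \<in> {t0 - R\<^sup>2..t0}"
      using t assms by (auto simp: dist_norm norm_minus_commute power2_le_iff_abs_le)
  qed
  then have "bounded ?K"
    by (rule bounded_subset[rotated]) (intro bounded_Times bounded_cball bounded_closed_interval)
  ultimately show ?thesis using compact_eq_bounded_closed by blast
qed

section \<open>The discrete gradient energy and its derivatives\<close>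

text \<open>A substitute for |grad u|^2 with step \<open>h\<close>, regular enough to be
  differentiated twice in space and once in time when \<open>u\<close> is C^{2,1}.\<close>

definition diff_energy :: "real \<Rightarrow> (real ^ 'n \<Rightarrow> real \<Rightarrow> real) \<Rightarrow> real ^ 'n \<Rightarrow> real \<Rightarrow> real" where
  "diff_energy h u x t = (\<Sum>i\<in>UNIV. (diff_quot i h (\<lambda>y. u y t) x)\<^sup>2)"

lemma
  assumes "C21_ancient u" "t < 0"
  shows C21_has_partial: "has_partial_x i (\<lambda>y. u y t) x"
    and C21_has_partial2: "has_partial_x i (partial_x j (\<lambda>y. u y t)) x"
    and C21_has_time_deriv: "(u x has_real_derivative time_deriv u x t) (at t)"
  using assms unfolding C21_ancient_def time_deriv_def
  by (auto simp: DERIV_deriv_iff_real_differentiable)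

lemma diff_energy_space_derivative:
  assumes "C21_ancient u" "t < 0"
  shows "((\<lambda>s. diff_energy h u (x + s *\<^sub>R axis j 1) t) has_real_derivative
           2 * (\<Sum>i\<in>UNIV. diff_quot i h (\<lambda>y. u y t) (x + s *\<^sub>R axis j 1)
                * diff_quot i h (partial_x j (\<lambda>y. u y t)) (x + s *\<^sub>R axis j 1))) (at s)"
  unfolding diff_energy_def
  by (auto intro!: derivative_eq_intros diff_quot_has_derivative C21_has_partial assms
      simp: sum_distrib_left mult_ac)

text \<open>Summed over \<open>j\<close>, this is a discrete Bochner identity: the squares form the
  discrete |D^2 u|^2, and the other terms pair the discrete gradient with that of the
  Laplacian.\<close>

lemma diff_energy_space_second_derivative:
  assumes "C21_ancient u" "t < 0"
  shows "((\<lambda>s. 2 * (\<Sum>i\<in>UNIV. diff_quot i h (\<lambda>y. u y t) (x + s *\<^sub>R axis j 1)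
                * diff_quot i h (partial_x j (\<lambda>y. u y t)) (x + s *\<^sub>R axis j 1))) has_real_derivative
           2 * (\<Sum>i\<in>UNIV. (diff_quot i h (partial_x j (\<lambda>y. u y t)) x)\<^sup>2
             + diff_quot i h (\<lambda>y. u y t) x * diff_quot i h (partial_x j (partial_x j (\<lambda>y. u y t))) x)) (at 0)"
proof -
  have "((\<lambda>s. diff_quot i h (\<lambda>y. u y t) (x + s *\<^sub>R axis j 1)
                * diff_quot i h (partial_x j (\<lambda>y. u y t)) (x + s *\<^sub>R axis j 1)) has_real_derivative
           (diff_quot i h (partial_x j (\<lambda>y. u y t)) x)\<^sup>2
             + diff_quot i h (\<lambda>y. u y t) x * diff_quot i h (partial_x j (partial_x j (\<lambda>y. u y t))) x) (at 0)"
    for i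
    using DERIV_mult[OF
        diff_quot_has_derivative[where i = i and h = h and s = 0, OF C21_has_partial[OF assms]]
        diff_quot_has_derivative[where i = i and h = h and s = 0, OF C21_has_partial2[OF assms]]]
    by (simp add: power2_eq_square mult_ac)
  then show ?thesis by (intro DERIV_cmult DERIV_sum)
qed

lemma diff_energy_time_derivative:
  assumes "C21_ancient u" "t < 0"
  shows "((\<lambda>t. diff_energy h u x t) has_real_derivative
           2 * (\<Sum>i\<in>UNIV. diff_quot i h (\<lambda>y. u y t) x * diff_quot i h (\<lambda>y. time_deriv u y t) x)) (at t)"
proof -
  have "((\<lambda>t. diff_quot i h (\<lambda>y. u y t) x) has_real_derivative diff_quot i h (\<lambda>y. time_deriv u y t) x) (at t)" for i
    unfolding diff_quot_def by (intro DERIV_cdivide DERIV_diff C21_has_time_deriv assms)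
  then show ?thesis unfolding diff_energy_def
    by (auto intro!: derivative_eq_intros simp: sum_distrib_left mult_ac)
qed

lemma continuous_on_diff_energy:
  assumes "C21_ancient u" "S \<subseteq> UNIV \<times> {..<0}"
  shows "continuous_on S (\<lambda>(x, t). diff_energy h u x t)"
proof -
  have c: "continuous_on (UNIV \<times> {..<0}) (\<lambda>(x, t). u x t)"
    using assms unfolding C21_ancient_def by blast
  have "continuous_on S (\<lambda>z. (\<lambda>(x, t). u x t) (fst z + a, snd z))" for a
    by (rule continuous_on_compose2[OF c]) (use assms(2) in \<open>auto intro!: continuous_intros\<close>)
  then have *: "continuous_on S (\<lambda>z. u (fst z + a) (snd z))" for a by simp
  show ?thesis
    unfolding diff_energy_def diff_quot_def case_prod_unfold divide_inverse
    using *[of 0] by (intro continuous_intros *) simp_all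
qed

section \<open>The maximum principle at a fixed step\<close>

text \<open>The weighted energy attains its maximum on the compact paraboloid. The optimality
  conditions along each axis and backward in time are then added up. The combination u_t -
  Laplacian(u) is kept intact inside the difference quotient, so that the equation can be inserted
  later.\<close>

lemma discrete_maximum_principle:
  fixes u :: "real ^ 'n \<Rightarrow> real \<Rightarrow> real" and m :: nat
  assumes C21: "C21_ancient u" and "t0 < 0" "R > 0" and nz: "diff_energy h u x0 t0 > 0" and "m > 0"
  obtains x t where "t \<le> t0" "cutoff R x0 t0 x t \<ge> 0"
    "diff_energy h u x0 t0 \<le> cutoff R x0 t0 x t ^ m * diff_energy h u x t"
    "\<And>j. cutoff R x0 t0 x t * (2 * (\<Sum>i\<in>UNIV. diff_quot i h (\<lambda>y. u y t) x
         * diff_quot i h (partial_x j (\<lambda>y. u y t)) x))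
       = real m * (2 * (x - x0) $ j / R\<^sup>2) * diff_energy h u x t"
    "2 * (cutoff R x0 t0 x t)\<^sup>2 * ((\<Sum>j\<in>UNIV. \<Sum>i\<in>UNIV. (diff_quot i h (partial_x j (\<lambda>y. u y t)) x)\<^sup>2)
        - (\<Sum>i\<in>UNIV. diff_quot i h (\<lambda>y. u y t) x
             * diff_quot i h (\<lambda>y. time_deriv u y t - laplacian (\<lambda>y. u y t) y) x))
      \<le> diff_energy h u x t * ((real m + 4 * ((real m)\<^sup>2 + real m) + 2 * real m * real CARD('n)) / R\<^sup>2)"
proof -
  let ?\<eta> = "cutoff R x0 t0" and ?z = "diff_energy h u"
  define K where "K = {(x, t). t \<le> t0 \<and> 0 \<le> ?\<eta> x t}"
  have K: "compact K" unfolding K_def by (rule compact_cutoff_domain[OF \<open>R > 0\<close>])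
  have K0: "(x0, t0) \<in> K" by (simp add: K_def cutoff_def)
  have "continuous_on K (\<lambda>(x, t). ?z x t)"
    using C21 by (rule continuous_on_diff_energy) (use \<open>t0 < 0\<close> in \<open>auto simp: K_def\<close>)
  then have "continuous_on K (\<lambda>w. (\<lambda>(x, t). ?\<eta> x t) w ^ m * (\<lambda>(x, t). ?z x t) w)"
    by (intro continuous_intros continuous_on_cutoff)
  from continuous_attains_sup[OF K _ this] K0 obtain w
    where "w \<in> K" "\<And>y. y \<in> K \<Longrightarrow> (\<lambda>(x, t). ?\<eta> x t) y ^ m * (\<lambda>(x, t). ?z x t) y
        \<le> (\<lambda>(x, t). ?\<eta> x t) w ^ m * (\<lambda>(x, t). ?z x t) w" by blast
  moreover obtain x t where "w = (x, t)" by (cases w)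
  ultimately have t: "t \<le> t0" "0 \<le> ?\<eta> x t" and
    mx: "\<And>y s. s \<le> t0 \<Longrightarrow> 0 \<le> ?\<eta> y s \<Longrightarrow> ?\<eta> y s ^ m * ?z y s \<le> ?\<eta> x t ^ m * ?z x t"
    by (auto simp: K_def)
  have ge: "?z x0 t0 \<le> ?\<eta> x t ^ m * ?z x t"
    using mx[of t0 x0] by (simp add: cutoff_def)
  have z0: "?z y s \<ge> 0" for y s unfolding diff_energy_def by (intro sum_nonneg) auto
  have zpos: "?z x t > 0" using nz ge z0[of x t] by (cases "?z x t = 0") auto
  \<comment> \<open>The maximal value is positive and \<open>m > 0\<close>, so the maximum avoids
    the part of the boundary where the cutoff vanishes; only the top \<open>t = t0\<close> remains
    possible.\<close>
  have epos: "?\<eta> x t > 0" using nz ge t \<open>m > 0\<close> by (cases "?\<eta> x t = 0") (auto simp: zero_power)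
  have "t < 0" using t \<open>t0 < 0\<close> by simp
  define D where "D i = diff_quot i h (\<lambda>y. u y t) x" for i
  define E where "E i j = diff_quot i h (partial_x j (\<lambda>y. u y t)) x" for i j
  define F where "F i j = diff_quot i h (partial_x j (partial_x j (\<lambda>y. u y t))) x" for i j
  define T where "T i = diff_quot i h (\<lambda>y. time_deriv u y t) x" for i

  have space: "?\<eta> x t * (2 * (\<Sum>i\<in>UNIV. D i * E i j)) = real m * (2 * (x - x0) $ j / R\<^sup>2) * ?z x t"
      "(?\<eta> x t)\<^sup>2 * (2 * (\<Sum>i\<in>UNIV. (E i j)\<^sup>2 + D i * F i j)) \<le> ?z x t *
        (((real m)\<^sup>2 + real m) * (2 * (x - x0) $ j / R\<^sup>2)\<^sup>2 + real m * ?\<eta> x t * (2 / R\<^sup>2))" for j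
  proof -
    let ?e = "\<lambda>s. ?\<eta> (x + s *\<^sub>R axis j 1) t" and ?y = "\<lambda>s. ?z (x + s *\<^sub>R axis j 1) t"
    note de = cutoff_space_derivative[of R x0 t0 x j t]
    note dy = diff_energy_space_derivative[OF C21 \<open>t < 0\<close>, of h x j]
    have de2: "((\<lambda>s. - (2 * ((x - x0) $ j + s) / R\<^sup>2)) has_real_derivative - (2 / R\<^sup>2)) (at 0)"
      unfolding divide_inverse by (auto intro!: derivative_eq_intros)
    have "eventually (\<lambda>s. ?e s > 0) (at 0)"
      by (rule order_tendstoD(1)[OF isContD[OF DERIV_isCont[OF de]]]) (use epos in simp)
    moreover have "eventually (\<lambda>s. ?y s > 0) (at 0)"
      by (rule order_tendstoD(1)[OF isContD[OF DERIV_isCont[OF dy]]]) (use zpos in simp)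
    ultimately have "eventually (\<lambda>s. ?e s > 0 \<and> ?y s > 0) (at 0)" by (rule eventually_conj)
    then obtain d where d: "d > 0" "\<And>s. s \<noteq> 0 \<Longrightarrow> \<bar>s\<bar> < d \<Longrightarrow> ?e s > 0 \<and> ?y s > 0"
      unfolding eventually_at by (auto simp: dist_real_def)
    then have pos: "?e s > 0" "?y s > 0" if "\<bar>s\<bar> < d" for s
      using that epos zpos by (cases "s = 0"; force)+
    \<comment> \<open>Positivity of the cutoff keeps the shifted point in the paraboloid, so the
      global maximality applies to it.\<close>
    have mx': "?e s ^ m * ?y s \<le> ?e 0 ^ m * ?y 0" if "\<bar>s\<bar> < d" for s
      using mx[of t "x + s *\<^sub>R axis j 1"] pos[OF that] t by simp
    note * = weighted_local_max[OF \<open>d > 0\<close> de de2 dy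
        diff_energy_space_second_derivative[OF C21 \<open>t < 0\<close>] pos mx']
    show "?\<eta> x t * (2 * (\<Sum>i\<in>UNIV. D i * E i j)) = real m * (2 * (x - x0) $ j / R\<^sup>2) * ?z x t"
      using *(1) by (simp add: D_def E_def)
    show "(?\<eta> x t)\<^sup>2 * (2 * (\<Sum>i\<in>UNIV. (E i j)\<^sup>2 + D i * F i j)) \<le> ?z x t *
        (((real m)\<^sup>2 + real m) * (2 * (x - x0) $ j / R\<^sup>2)\<^sup>2 + real m * ?\<eta> x t * (2 / R\<^sup>2))"
      using *(2) by (simp add: D_def E_def F_def power2_eq_square)
  qed

  have time: "- real m * (1 / R\<^sup>2) * ?z x t \<le> ?\<eta> x t * (2 * (\<Sum>i\<in>UNIV. D i * T i))"
  proof -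
    note de = cutoff_time_derivative[of R x0 t0 x t]
    note dy = diff_energy_time_derivative[OF C21 \<open>t < 0\<close>, of h x]
    have "eventually (\<lambda>s. ?\<eta> x s > 0 \<and> ?z x s > 0) (at t)"
      by (rule eventually_conj[OF order_tendstoD(1)[OF isContD[OF DERIV_isCont[OF de]] epos]
            order_tendstoD(1)[OF isContD[OF DERIV_isCont[OF dy]] zpos]])
    then obtain d where d: "d > 0" "\<And>s. s \<noteq> t \<Longrightarrow> \<bar>s - t\<bar> < d \<Longrightarrow> ?\<eta> x s > 0 \<and> ?z x s > 0"
      unfolding eventually_at by (auto simp: dist_real_def)
    then have pos: "?\<eta> x s > 0" "?z x s > 0" if "t - d < s" "s \<le> t" for s
      using that epos zpos by (cases "s = t"; force)+
    have mx': "?\<eta> x s ^ m * ?z x s \<le> ?\<eta> x t ^ m * ?z x t" if "t - d < s" "s \<le> t" for s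
      using mx[of s x] pos[OF that] that t by simp
    show ?thesis
      using weighted_left_max[OF \<open>d > 0\<close> de dy pos mx'] by (simp add: D_def T_def)
  qed

  define G where "G = (\<Sum>i\<in>UNIV. D i * T i) - (\<Sum>j\<in>UNIV. \<Sum>i\<in>UNIV. D i * F i j)"
  have lap: "diff_quot i h (\<lambda>y. time_deriv u y t - laplacian (\<lambda>y. u y t) y) x = T i - (\<Sum>j\<in>UNIV. F i j)" for i
    unfolding T_def F_def diff_quot_def laplacian_def
    by (simp add: sum_divide_distrib sum_subtractf diff_divide_distrib)
  have G: "(\<Sum>i\<in>UNIV. D i * (T i - (\<Sum>j\<in>UNIV. F i j))) = G"
    unfolding G_def right_diff_distrib sum_subtractf sum_distrib_left
    by (subst (2) sum.swap) simp
  have cu: "?\<eta> x t \<le> 1" using t by (simp add: cutoff_le_one)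
  have nx: "(norm (x - x0))\<^sup>2 \<le> R\<^sup>2"
    using cutoff_nonneg_iff[THEN iffD1, OF \<open>R > 0\<close> t(2)] t(1) by linarith
  \<comment> \<open>Summing the second-order conditions over \<open>j\<close> and subtracting the
    cutoff times the time condition isolates the Hessian squares and \<open>G\<close>.\<close>
  have "2 * (?\<eta> x t)\<^sup>2 * ((\<Sum>j\<in>UNIV. \<Sum>i\<in>UNIV. (E i j)\<^sup>2) - G)
     = (\<Sum>j\<in>UNIV. (?\<eta> x t)\<^sup>2 * (2 * (\<Sum>i\<in>UNIV. (E i j)\<^sup>2 + D i * F i j)))
       - ?\<eta> x t * (?\<eta> x t * (2 * (\<Sum>i\<in>UNIV. D i * T i)))"
    unfolding G_def sum_distrib_left[symmetric] sum.distrib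
    by (simp add: algebra_simps power2_eq_square)
  also have "\<dots> \<le> (\<Sum>j\<in>UNIV. ?z x t *
        (((real m)\<^sup>2 + real m) * (2 * (x - x0) $ j / R\<^sup>2)\<^sup>2 + real m * ?\<eta> x t * (2 / R\<^sup>2)))
       - ?\<eta> x t * (- real m * (1 / R\<^sup>2) * ?z x t)"
    using epos by (intro diff_mono sum_mono space(2) mult_left_mono time) auto
  also have "\<dots> = ?z x t * (((real m)\<^sup>2 + real m) * (4 * (norm (x - x0))\<^sup>2 / R ^ 4)
        + real CARD('n) * (real m * ?\<eta> x t * (2 / R\<^sup>2)) + real m * ?\<eta> x t / R\<^sup>2)"
  proof -
    have sq: "(2 * d / R\<^sup>2)\<^sup>2 = 4 / R ^ 4 * (d * d)" for d
      by (simp add: power2_eq_square eval_nat_numeral)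
    have "(\<Sum>j\<in>UNIV. (2 * (x - x0) $ j / R\<^sup>2)\<^sup>2) = 4 * (norm (x - x0))\<^sup>2 / R ^ 4"
      unfolding power2_norm_eq_inner inner_vec_def sq by (simp add: sum_distrib_left sum_divide_distrib)
    then show ?thesis
      by (simp add: sum_distrib_left[symmetric] sum.distrib algebra_simps add_divide_distrib)
  qed
  \<comment> \<open>On the paraboloid |x - x0| <= R and the cutoff is at most 1, so every term
    becomes a multiple of 1/R^2.\<close>
  also have "\<dots> \<le> ?z x t * (((real m)\<^sup>2 + real m) * (4 / R\<^sup>2)
        + real CARD('n) * (real m * 1 * (2 / R\<^sup>2)) + real m * 1 / R\<^sup>2)"
  proof -
    have "(norm (x - x0))\<^sup>2 / R ^ 4 \<le> R\<^sup>2 / R ^ 4" by (intro divide_right_mono nx) auto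
    also have "\<dots> = 1 / R\<^sup>2" using \<open>R > 0\<close> by (simp add: field_simps eval_nat_numeral)
    finally have "4 * (norm (x - x0))\<^sup>2 / R ^ 4 \<le> 4 / R\<^sup>2" by simp
    then show ?thesis
      using cu zpos epos
      by (intro mult_left_mono add_mono divide_right_mono mult_right_mono) auto
  qed
  also have "\<dots> = ?z x t * ((real m + 4 * ((real m)\<^sup>2 + real m) + 2 * real m * real CARD('n)) / R\<^sup>2)"
    by (simp add: algebra_simps add_divide_distrib)
  finally have main: "2 * (?\<eta> x t)\<^sup>2 * ((\<Sum>j\<in>UNIV. \<Sum>i\<in>UNIV. (E i j)\<^sup>2) - G)
    \<le> ?z x t * ((real m + 4 * ((real m)\<^sup>2 + real m) + 2 * real m * real CARD('n)) / R\<^sup>2)" .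
  show ?thesis
    by (rule that[OF t ge space(1)[unfolded D_def E_def]])
      (use main G lap in \<open>simp add: D_def E_def\<close>)
qed

section \<open>Passage to the limit of vanishing step\<close>

text \<open>A zero of a nonnegative function is a minimum. This makes a solution positive wherever
  its gradient is nonzero.\<close>

lemma nonneg_zero_partial:
  fixes f :: "real ^ 'n \<Rightarrow> real"
  assumes "\<And>y. f y \<ge> 0" "f x = 0" "\<And>y. has_partial_x i f y"
  shows "partial_x i f x = 0"
  by (rule DERIV_local_min[where d = 1 and f = "\<lambda>s. f (x + s *\<^sub>R axis i 1)" and x = 0])
    (use has_partial_x_has_derivative[OF assms(3), where s = 0 and x = x] assms in auto)

lemma norm_gradient_squared: "(norm (gradient f x))\<^sup>2 = (\<Sum>i\<in>UNIV. (partial_x i f x)\<^sup>2)"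
  unfolding power2_norm_eq_inner inner_vec_def gradient_def by (simp add: power2_eq_square)

lemma norm_powr_square: "norm v powr q = ((norm v)\<^sup>2) powr (q / 2)"
  by (cases "v = 0") (simp_all add: powr_powr flip: powr_numeral)

text \<open>The difference quotient of $\partial_j u$ in direction $i$ tends to $\partial_i\partial_j u$, and the
  order of these two derivatives is the same in the gradient condition and in the reaction term, so
  symmetry of the Hessian is never needed. The positivity of $u$ and of $|\nabla u|$ at the point makes
  the powers differentiable there.\<close>

lemma bernstein_maximum_point:
  fixes u :: "real ^ 'n \<Rightarrow> real \<Rightarrow> real" and m :: nat
  assumes sol: "nonneg_ancient_solution p q M u" and "t0 < 0" "R > 0" "m > 0"
    and nz: "gradient (\<lambda>y. u y t0) x0 \<noteq> 0"
  obtains x t where "t < 0" "0 < cutoff R x0 t0 x t" "cutoff R x0 t0 x t \<le> 1" "norm (x - x0) \<le> R"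
    "u x t > 0" "gradient (\<lambda>y. u y t) x \<noteq> 0"
    "(norm (gradient (\<lambda>y. u y t0) x0))\<^sup>2 \<le> cutoff R x0 t0 x t ^ m * (norm (gradient (\<lambda>y. u y t) x))\<^sup>2"
    "\<And>j. cutoff R x0 t0 x t * (2 * (\<Sum>i\<in>UNIV. partial_x i (\<lambda>y. u y t) x
         * partial_x i (partial_x j (\<lambda>y. u y t)) x))
       = real m * (2 * (x - x0) $ j / R\<^sup>2) * (norm (gradient (\<lambda>y. u y t) x))\<^sup>2"
    "2 * (cutoff R x0 t0 x t)\<^sup>2 * ((\<Sum>j\<in>UNIV. \<Sum>i\<in>UNIV. (partial_x i (partial_x j (\<lambda>y. u y t)) x)\<^sup>2)
        - (\<Sum>i\<in>UNIV. partial_x i (\<lambda>y. u y t) x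
             * (p * u x t powr (p - 1) * partial_x i (\<lambda>y. u y t) x
                + M * (q / 2 * (norm (gradient (\<lambda>y. u y t) x))\<^sup>2 powr (q / 2 - 1)
                    * (2 * (\<Sum>k\<in>UNIV. partial_x k (\<lambda>y. u y t) x * partial_x i (partial_x k (\<lambda>y. u y t)) x))))))
      \<le> (norm (gradient (\<lambda>y. u y t) x))\<^sup>2
          * ((real m + 4 * ((real m)\<^sup>2 + real m) + 2 * real m * real CARD('n)) / R\<^sup>2)"
proof -
  let ?B = "(real m + 4 * ((real m)\<^sup>2 + real m) + 2 * real m * real CARD('n)) / R\<^sup>2"
  let ?\<eta> = "cutoff R x0 t0"
  let ?g = "\<lambda>x t. norm (gradient (\<lambda>y. u y t) x)"
  have C21: "C21_ancient u" and u0: "\<And>x t. t < 0 \<Longrightarrow> u x t \<ge> 0"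
    and eq: "\<And>x t. t < 0 \<Longrightarrow> time_deriv u x t - laplacian (\<lambda>y. u y t) x
                  = u x t powr p + M * ?g x t powr q"
    using sol unfolding nonneg_ancient_solution_def by auto
  have cont0: "continuous_on (UNIV \<times> {..<0}) (\<lambda>(x, t). u x t)"
    and cont1: "\<And>i. continuous_on (UNIV \<times> {..<0}) (\<lambda>(x, t). partial_x i (\<lambda>y. u y t) x)"
    and cont2: "\<And>i j. continuous_on (UNIV \<times> {..<0}) (\<lambda>(x, t). partial_x i (partial_x j (\<lambda>y. u y t)) x)"
    using C21 unfolding C21_ancient_def by auto
  note lim1 = diff_quot_tendsto[where g = u, OF C21_has_partial[OF C21] cont1]
  note lim2 = diff_quot_tendsto[where g = "\<lambda>y t. partial_x j (\<lambda>y. u y t) y" for j, OF C21_has_partial2[OF C21] cont2]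
  have limc: "(\<lambda>n. f (xs n) (ts n)) \<longlonglongrightarrow> f x t"
    if "continuous_on (UNIV \<times> {..<0}) (\<lambda>(x, t). f x t)" "xs \<longlonglongrightarrow> x" "ts \<longlonglongrightarrow> t" "t < 0" "\<And>n. ts n < 0"
    for f :: "real ^ 'n \<Rightarrow> real \<Rightarrow> real" and xs ts x t
    using continuous_on_tendsto_compose[OF that(1) tendsto_Pair[OF that(2,3)]] that(4,5) by simp
  have limE: "(\<lambda>n. diff_energy (h n) u (xs n) (ts n)) \<longlonglongrightarrow> (?g x t)\<^sup>2"
    if "\<And>n. h n > 0" "h \<longlonglongrightarrow> 0" "xs \<longlonglongrightarrow> x" "ts \<longlonglongrightarrow> t" "t < 0" "\<And>n. ts n < 0" for h xs ts x t
    unfolding diff_energy_def norm_gradient_squared by (intro tendsto_intros lim1 that)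

  have "(\<lambda>n. diff_energy (1 / real (Suc n)) u x0 t0) \<longlonglongrightarrow> (?g x0 t0)\<^sup>2"
    by (rule limE[OF _ LIMSEQ_Suc[OF lim_1_over_n] tendsto_const tendsto_const]) (use \<open>t0 < 0\<close> in auto)
  moreover have g0: "(?g x0 t0)\<^sup>2 > 0" using nz by simp
  ultimately have "eventually (\<lambda>n. diff_energy (1 / real (Suc n)) u x0 t0 > 0) sequentially"
    by (rule order_tendstoD(1))
  then obtain k where k: "\<And>n. n \<ge> k \<Longrightarrow> diff_energy (1 / real (Suc n)) u x0 t0 > 0"
    unfolding eventually_sequentially by blast
  \<comment> \<open>The shift by \<open>k\<close> discards the steps for which the discrete energy
    at (x0, t0) might vanish.\<close>
  define h where "h n = 1 / real (Suc (n + k))" for n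
  have h: "h n > 0" "diff_energy (h n) u x0 t0 > 0" for n using k[of "n + k"] by (auto simp: h_def)
  have h0: "h \<longlonglongrightarrow> 0"
    using LIMSEQ_ignore_initial_segment[OF LIMSEQ_Suc[OF lim_1_over_n], of k] unfolding h_def by simp
  define good where "good n w \<longleftrightarrow> (case w of (x, t) \<Rightarrow> t \<le> t0 \<and> ?\<eta> x t \<ge> 0 \<and>
    diff_energy (h n) u x0 t0 \<le> ?\<eta> x t ^ m * diff_energy (h n) u x t \<and>
    (\<forall>j. ?\<eta> x t * (2 * (\<Sum>i\<in>UNIV. diff_quot i (h n) (\<lambda>y. u y t) x
         * diff_quot i (h n) (partial_x j (\<lambda>y. u y t)) x))
       = real m * (2 * (x - x0) $ j / R\<^sup>2) * diff_energy (h n) u x t) \<and>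
    2 * (?\<eta> x t)\<^sup>2 * ((\<Sum>j\<in>UNIV. \<Sum>i\<in>UNIV. (diff_quot i (h n) (partial_x j (\<lambda>y. u y t)) x)\<^sup>2)
        - (\<Sum>i\<in>UNIV. diff_quot i (h n) (\<lambda>y. u y t) x
             * diff_quot i (h n) (\<lambda>y. time_deriv u y t - laplacian (\<lambda>y. u y t) y) x))
      \<le> diff_energy (h n) u x t * ?B)" for n w
  have "\<exists>w. good n w" for n
  proof -
    obtain x t where "good n (x, t)"
      by (rule discrete_maximum_principle[OF C21 \<open>t0 < 0\<close> \<open>R > 0\<close> h(2)[of n] \<open>m > 0\<close>])
        (auto simp: good_def)
    then show ?thesis by blast
  qed
  then obtain W where W: "\<And>n. good n (W n)" by metis
  define K where "K = {(x, t). t \<le> t0 \<and> 0 \<le> ?\<eta> x t}"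
  have "compact K" unfolding K_def by (rule compact_cutoff_domain[OF \<open>R > 0\<close>])
  moreover have "W n \<in> K" for n using W[of n] by (cases "W n") (auto simp: K_def good_def)
  \<comment> \<open>The paraboloid does not depend on the step, so the maximum points have a
    convergent subsequence in it.\<close>
  ultimately obtain w r where w: "w \<in> K" "strict_mono r" "(W \<circ> r) \<longlonglongrightarrow> w"
    unfolding compact_def by blast
  obtain x t where wxt: "w = (x, t)" by (cases w)
  define xs where "xs n = fst (W (r n))" for n
  define ts where "ts n = snd (W (r n))" for n
  define hs where "hs n = h (r n)" for n
  have good: "good (r n) (xs n, ts n)" for n using W[of "r n"] by (simp add: xs_def ts_def)
  have xs: "xs \<longlonglongrightarrow> x" and ts: "ts \<longlonglongrightarrow> t"
    using tendsto_fst[OF w(3)] tendsto_snd[OF w(3)] by (simp_all add: xs_def[abs_def] ts_def[abs_def] wxt o_def)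
  have hs: "hs n > 0" for n by (simp add: hs_def h)
  have hs0: "hs \<longlonglongrightarrow> 0" using LIMSEQ_subseq_LIMSEQ[OF h0 w(2)] by (simp add: hs_def[abs_def] o_def)
  have t: "t \<le> t0" "0 \<le> ?\<eta> x t" using w(1) by (auto simp: K_def wxt)
  have "t < 0" using t \<open>t0 < 0\<close> by simp
  have tn: "ts n < 0" for n using good[of n] \<open>t0 < 0\<close> by (auto simp: good_def)
  note conv = hs hs0 xs ts \<open>t < 0\<close> tn
  note L1 = lim1[OF _ hs hs0 xs ts \<open>t < 0\<close> tn] and L2 = lim2[OF _ hs hs0 xs ts \<open>t < 0\<close> tn]
  note LE = limE[OF conv]
  have LC: "(\<lambda>n. ?\<eta> (xs n) (ts n)) \<longlonglongrightarrow> ?\<eta> x t"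
    by (rule limc[OF continuous_on_cutoff xs ts \<open>t < 0\<close> tn])
  have "(\<lambda>n. diff_energy (hs n) u x0 t0) \<longlonglongrightarrow> (?g x0 t0)\<^sup>2"
    by (rule limE[OF hs hs0 tendsto_const tendsto_const]) (use \<open>t0 < 0\<close> in auto)
  \<comment> \<open>The comparison with (x0, t0) survives the limit and forces both the cutoff and
    the gradient to be nonzero at the limit point.\<close>
  then have ge: "(?g x0 t0)\<^sup>2 \<le> ?\<eta> x t ^ m * (?g x t)\<^sup>2"
    by (rule LIMSEQ_le[OF _ tendsto_mult[OF tendsto_power[OF LC] LE]])
      (use good in \<open>auto simp: good_def hs_def\<close>)
  have prodpos: "?\<eta> x t ^ m * (?g x t)\<^sup>2 > 0" using ge g0 by linarith
  then have gpos: "(?g x t)\<^sup>2 > 0" by (cases "?g x t = 0") auto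
  have epos: "?\<eta> x t > 0" using prodpos t \<open>m > 0\<close> by (cases "?\<eta> x t = 0") (auto simp: zero_power)
  have upos: "u x t > 0"
  proof (rule ccontr)
    assume "\<not> u x t > 0"
    then have "u x t = 0" using u0[OF \<open>t < 0\<close>, of x] by simp
    then have "partial_x i (\<lambda>y. u y t) x = 0" for i
      by (intro nonneg_zero_partial u0[OF \<open>t < 0\<close>] C21_has_partial[OF C21 \<open>t < 0\<close>])
    then have "(?g x t)\<^sup>2 = 0" unfolding norm_gradient_squared by simp
    with gpos show False by simp
  qed
  have critical: "?\<eta> x t * (2 * (\<Sum>i\<in>UNIV. partial_x i (\<lambda>y. u y t) x * partial_x i (partial_x j (\<lambda>y. u y t)) x))
       = real m * (2 * (x - x0) $ j / R\<^sup>2) * (?g x t)\<^sup>2" for j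
  proof (rule LIMSEQ_unique)
    show "(\<lambda>n. ?\<eta> (xs n) (ts n) * (2 * (\<Sum>i\<in>UNIV. diff_quot i (hs n) (\<lambda>y. u y (ts n)) (xs n)
         * diff_quot i (hs n) (partial_x j (\<lambda>y. u y (ts n))) (xs n)))) \<longlonglongrightarrow>
      ?\<eta> x t * (2 * (\<Sum>i\<in>UNIV. partial_x i (\<lambda>y. u y t) x * partial_x i (partial_x j (\<lambda>y. u y t)) x))"
      by (intro tendsto_intros LC L1 L2)
    have "(\<lambda>n. real m * (2 * (xs n - x0) $ j / R\<^sup>2) * diff_energy (hs n) u (xs n) (ts n)) \<longlonglongrightarrow>
      real m * (2 * (x - x0) $ j / R\<^sup>2) * (?g x t)\<^sup>2"
      using \<open>R > 0\<close> by (intro tendsto_intros LE xs) auto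
    then show "(\<lambda>n. ?\<eta> (xs n) (ts n) * (2 * (\<Sum>i\<in>UNIV. diff_quot i (hs n) (\<lambda>y. u y (ts n)) (xs n)
         * diff_quot i (hs n) (partial_x j (\<lambda>y. u y (ts n))) (xs n)))) \<longlonglongrightarrow>
      real m * (2 * (x - x0) $ j / R\<^sup>2) * (?g x t)\<^sup>2"
      using good by (simp add: good_def hs_def)
  qed

  define P where "P i = partial_x i (\<lambda>y. u y t) x" for i
  define H where "H i j = partial_x i (partial_x j (\<lambda>y. u y t)) x" for i j
  define Q where "Q i = p * u x t powr (p - 1) * P i
      + M * (q / 2 * (?g x t)\<^sup>2 powr (q / 2 - 1) * (2 * (\<Sum>k\<in>UNIV. P k * H i k)))" for i
  \<comment> \<open>The equation replaces u_t - Laplacian(u) by powers of \<open>u\<close> and of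
    |grad u|^2 before the limit is taken; \<open>Q\<close> is the formal derivative of that
    right-hand side.\<close>
  have LQ: "(\<lambda>n. diff_quot i (hs n) (\<lambda>y. time_deriv u y (ts n) - laplacian (\<lambda>y. u y (ts n)) y) (xs n)) \<longlonglongrightarrow> Q i" for i
  proof -
    define ys where "ys n = xs n + hs n *\<^sub>R axis i 1" for n
    have "ys \<longlonglongrightarrow> x + 0 *\<^sub>R axis i 1" unfolding ys_def by (intro tendsto_intros xs hs0)
    then have ys: "ys \<longlonglongrightarrow> x" by simp
    have LP: "(\<lambda>n. partial_x k (\<lambda>y. u y (ts n)) (zs n)) \<longlonglongrightarrow> P k" if "zs \<longlonglongrightarrow> x" for zs k
      unfolding P_def by (rule limc[OF cont1 that ts \<open>t < 0\<close> tn])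
    have Lg: "(\<lambda>n. (?g (zs n) (ts n))\<^sup>2) \<longlonglongrightarrow> (?g x t)\<^sup>2" if "zs \<longlonglongrightarrow> x" for zs
      unfolding norm_gradient_squared P_def[symmetric] by (intro tendsto_intros LP that)
    \<comment> \<open>Factoring a^2 - b^2 = (a + b)(a - b) reduces the quotient of |grad u|^2 to
      quotients of first derivatives, whose limits are second derivatives.\<close>
    have Ldg: "(\<lambda>n. ((?g (ys n) (ts n))\<^sup>2 - (?g (xs n) (ts n))\<^sup>2) / hs n) \<longlonglongrightarrow> 2 * (\<Sum>k\<in>UNIV. P k * H i k)"
    proof -
      have "(\<lambda>n. \<Sum>k\<in>UNIV. (partial_x k (\<lambda>y. u y (ts n)) (ys n) + partial_x k (\<lambda>y. u y (ts n)) (xs n))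
          * diff_quot i (hs n) (partial_x k (\<lambda>y. u y (ts n))) (xs n)) \<longlonglongrightarrow> (\<Sum>k\<in>UNIV. (P k + P k) * H i k)"
        unfolding H_def by (intro tendsto_intros LP L2 xs ys)
      moreover have "(\<Sum>k\<in>UNIV. (P k + P k) * H i k) = 2 * (\<Sum>k\<in>UNIV. P k * H i k)"
        unfolding sum_distrib_left by (simp add: algebra_simps)
      moreover have "((?g (ys n) (ts n))\<^sup>2 - (?g (xs n) (ts n))\<^sup>2) / hs n =
        (\<Sum>k\<in>UNIV. (partial_x k (\<lambda>y. u y (ts n)) (ys n) + partial_x k (\<lambda>y. u y (ts n)) (xs n))
          * diff_quot i (hs n) (partial_x k (\<lambda>y. u y (ts n))) (xs n))" for n
        unfolding norm_gradient_squared diff_quot_def ys_def[symmetric] sum_subtractf[symmetric] sum_divide_distrib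
        by (intro sum.cong) (auto simp: power2_eq_square algebra_simps)
      ultimately show ?thesis by simp
    qed
    have "(\<lambda>n. (u (ys n) (ts n) powr p - u (xs n) (ts n) powr p) / hs n) \<longlonglongrightarrow> p * u x t powr (p - 1) * P i"
      by (rule powr_diff_quot_tendsto[OF limc[OF cont0 xs ts \<open>t < 0\<close> tn] limc[OF cont0 ys ts \<open>t < 0\<close> tn] upos])
        (use L1[of i] in \<open>simp add: diff_quot_def ys_def P_def\<close>)
    then have "(\<lambda>n. (u (ys n) (ts n) powr p - u (xs n) (ts n) powr p) / hs n
        + M * (((?g (ys n) (ts n))\<^sup>2 powr (q / 2) - (?g (xs n) (ts n))\<^sup>2 powr (q / 2)) / hs n)) \<longlonglongrightarrow> Q i"
      unfolding Q_def
      by (intro tendsto_intros powr_diff_quot_tendsto[OF Lg[OF xs] Lg[OF ys] gpos Ldg])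
    moreover have "diff_quot i (hs n) (\<lambda>y. time_deriv u y (ts n) - laplacian (\<lambda>y. u y (ts n)) y) (xs n)
      = (u (ys n) (ts n) powr p - u (xs n) (ts n) powr p) / hs n
        + M * (((?g (ys n) (ts n))\<^sup>2 powr (q / 2) - (?g (xs n) (ts n))\<^sup>2 powr (q / 2)) / hs n)" for n
      unfolding diff_quot_def eq[OF tn] norm_powr_square ys_def[symmetric]
      using hs[of n] by (simp add: field_simps)
    ultimately show ?thesis by simp
  qed
  have final: "2 * (?\<eta> x t)\<^sup>2 * ((\<Sum>j\<in>UNIV. \<Sum>i\<in>UNIV. (H i j)\<^sup>2) - (\<Sum>i\<in>UNIV. P i * Q i)) \<le> (?g x t)\<^sup>2 * ?B"
  proof (rule LIMSEQ_le)
    show "(\<lambda>n. diff_energy (hs n) u (xs n) (ts n) * ?B) \<longlonglongrightarrow> (?g x t)\<^sup>2 * ?B"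
      by (intro tendsto_intros LE)
    show "(\<lambda>n. 2 * (?\<eta> (xs n) (ts n))\<^sup>2 * ((\<Sum>j\<in>UNIV. \<Sum>i\<in>UNIV. (diff_quot i (hs n) (partial_x j (\<lambda>y. u y (ts n))) (xs n))\<^sup>2)
        - (\<Sum>i\<in>UNIV. diff_quot i (hs n) (\<lambda>y. u y (ts n)) (xs n)
             * diff_quot i (hs n) (\<lambda>y. time_deriv u y (ts n) - laplacian (\<lambda>y. u y (ts n)) y) (xs n))))
      \<longlonglongrightarrow> 2 * (?\<eta> x t)\<^sup>2 * ((\<Sum>j\<in>UNIV. \<Sum>i\<in>UNIV. (H i j)\<^sup>2) - (\<Sum>i\<in>UNIV. P i * Q i))"
      unfolding P_def H_def by (intro tendsto_intros LC L1 L2 LQ)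
  qed (use good in \<open>auto simp: good_def hs_def\<close>)
  have "(norm (x - x0))\<^sup>2 \<le> R\<^sup>2"
    using cutoff_nonneg_iff[THEN iffD1, OF \<open>R > 0\<close> t(2)] t(1) by linarith
  then have nx: "norm (x - x0) \<le> R" using \<open>R > 0\<close> by (simp add: power2_le_iff_abs_le)
  have "?\<eta> x t \<le> 1" using t by (simp add: cutoff_le_one)
  moreover have "gradient (\<lambda>y. u y t) x \<noteq> 0" using gpos by auto
  ultimately show ?thesis
    by (intro that[OF \<open>t < 0\<close> epos _ nx upos _ ge critical final[unfolded H_def Q_def P_def]])
qed

section \<open>The gradient estimate and the Liouville conclusion\<close>

text \<open>At the maximum point, the Hessian bound and the absorption of the reaction term leave a
  quadratic inequality for the cutoff times M |grad u|^(q-1) R. The resulting bound is independent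
  of \<open>R\<close>, so the gradient at (x0, t0) decays as \<open>R\<close> grows.\<close>

lemma gradient_bound:
  fixes u :: "real ^ 'n \<Rightarrow> real \<Rightarrow> real" and m :: nat
  assumes sol: "nonneg_ancient_solution p q M u" and pq: "p > 1" "q > 1" "q < 2 * p / (p + 1)" and "M > 0"
    and dec: "\<And>x t. t < 0 \<Longrightarrow> time_deriv u x t \<le> 0"
    and small: "\<And>x t. t < 0 \<Longrightarrow> u x t \<le> (2 * real CARD('n) * p) powr (- q / (2 * p - (p + 1) * q))
                    * M powr (2 / (2 * p - (p + 1) * q))"
    and m: "real m * (q - 1) \<ge> 2" and "t0 < 0" "R > 0"
  shows "M * norm (gradient (\<lambda>y. u y t0) x0) powr (q - 1) * R
    \<le> 2 * real CARD('n) * q * m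
        + real CARD('n) * (real m + 4 * ((real m)\<^sup>2 + real m) + 2 * real m * real CARD('n)) + 1"
    (is "_ \<le> ?C")
proof (cases "gradient (\<lambda>y. u y t0) x0 = 0")
  case True
  have "?C \<ge> 0" using pq by (intro add_nonneg_nonneg mult_nonneg_nonneg) auto
  with True show ?thesis by simp
next
  case False
  let ?N = "real CARD('n)"
  define B where "B = real m + 4 * ((real m)\<^sup>2 + real m) + 2 * real m * ?N"
  have B: "B \<ge> 0" unfolding B_def by (intro add_nonneg_nonneg mult_nonneg_nonneg) auto
  have "m > 0" using m by (cases "m = 0") auto
  define v where "v = norm (gradient (\<lambda>y. u y t0) x0)"
  obtain x t where t: "t < 0" and e: "0 < cutoff R x0 t0 x t" "cutoff R x0 t0 x t \<le> 1"
    and nx: "norm (x - x0) \<le> R" and u: "u x t > 0" and g: "gradient (\<lambda>y. u y t) x \<noteq> 0"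
    and ge: "v\<^sup>2 \<le> cutoff R x0 t0 x t ^ m * (norm (gradient (\<lambda>y. u y t) x))\<^sup>2"
    and crit: "\<And>j. cutoff R x0 t0 x t * (2 * (\<Sum>i\<in>UNIV. partial_x i (\<lambda>y. u y t) x
         * partial_x i (partial_x j (\<lambda>y. u y t)) x))
       = real m * (2 * (x - x0) $ j / R\<^sup>2) * (norm (gradient (\<lambda>y. u y t) x))\<^sup>2"
    and main: "2 * (cutoff R x0 t0 x t)\<^sup>2 * ((\<Sum>j\<in>UNIV. \<Sum>i\<in>UNIV. (partial_x i (partial_x j (\<lambda>y. u y t)) x)\<^sup>2)
        - (\<Sum>i\<in>UNIV. partial_x i (\<lambda>y. u y t) x
             * (p * u x t powr (p - 1) * partial_x i (\<lambda>y. u y t) x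
                + M * (q / 2 * (norm (gradient (\<lambda>y. u y t) x))\<^sup>2 powr (q / 2 - 1)
                    * (2 * (\<Sum>k\<in>UNIV. partial_x k (\<lambda>y. u y t) x * partial_x i (partial_x k (\<lambda>y. u y t)) x))))))
      \<le> (norm (gradient (\<lambda>y. u y t) x))\<^sup>2 * (B / R\<^sup>2)"
    unfolding v_def B_def by (rule bernstein_maximum_point[OF sol \<open>t0 < 0\<close> \<open>R > 0\<close> \<open>m > 0\<close> False]) blast
  define G where "G = gradient (\<lambda>y. u y t) x"
  define P where "P i = partial_x i (\<lambda>y. u y t) x" for i
  define H where "H i j = partial_x i (partial_x j (\<lambda>y. u y t)) x" for i j
  define \<eta> where "\<eta> = cutoff R x0 t0 x t"
  define U where "U = u x t"
  define z where "z = (norm G)\<^sup>2"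
  define S where "S = (\<Sum>j\<in>UNIV. \<Sum>i\<in>UNIV. (H i j)\<^sup>2)"
  define A where "A = U powr (2 * p) + M\<^sup>2 * z powr q"
  \<comment> \<open>This is |grad u|^(q-1) at the maximum point.\<close>
  define y where "y = z powr ((q - 1) / 2)"
  note e = e[folded \<eta>_def] and u = u[folded U_def] and g = g[folded G_def]
  note ge = ge[folded \<eta>_def G_def, folded z_def]
    and crit = crit[folded \<eta>_def G_def P_def H_def, folded z_def]
    and main = main[folded \<eta>_def G_def P_def H_def U_def, folded z_def S_def]
  have z: "z > 0" using g by (simp add: z_def)
  have sq: "(U powr p + M * z powr (q / 2))\<^sup>2 \<ge> A"
  proof -
    have "(U powr p)\<^sup>2 = U powr (2 * p)" "(z powr (q / 2))\<^sup>2 = z powr q"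
      using u z by (simp_all add: power2_eq_square powr_add[symmetric])
    then show ?thesis
      unfolding A_def power2_sum power_mult_distrib using \<open>M > 0\<close> by simp
  qed
  \<comment> \<open>Since u_t <= 0, minus the trace of the Hessian dominates the nonnegative
    right-hand side of the equation, so the inequality may be squared. Cauchy-Schwarz then bounds
    the squared trace by N times the sum of squared diagonal entries.\<close>
  have S: "A \<le> ?N * S"
  proof -
    have "time_deriv u x t - (\<Sum>i\<in>UNIV. H i i) = U powr p + M * z powr (q / 2)"
      using sol t unfolding nonneg_ancient_solution_def laplacian_def H_def U_def z_def G_def
      by (simp flip: norm_powr_square)
    with dec[OF t, of x] have "U powr p + M * z powr (q / 2) \<le> - (\<Sum>i\<in>UNIV. H i i)" by linarith
    then have "(U powr p + M * z powr (q / 2))\<^sup>2 \<le> (- (\<Sum>i\<in>UNIV. H i i))\<^sup>2"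
      using \<open>M > 0\<close> by (intro power_mono) auto
    then have "A \<le> (\<Sum>i\<in>UNIV. H i i)\<^sup>2" using sq by simp
    also have "\<dots> \<le> (\<Sum>i\<in>UNIV. (H i i)\<^sup>2) * ?N" by (rule sum_squared_le_sum_of_squares)
    also have "\<dots> \<le> S * ?N"
      unfolding S_def by (intro mult_right_mono sum_mono member_le_sum) auto
    finally show ?thesis by (simp add: mult.commute)
  qed
  have absorb: "2 * ?N * p * U powr (p - 1) * z \<le> A"
    unfolding A_def by (rule reaction_absorption[OF pq _ \<open>M > 0\<close> u z]) (use small[OF t] in \<open>auto simp: U_def\<close>)
  have zP: "z = (\<Sum>i\<in>UNIV. P i * P i)"
    unfolding z_def G_def norm_gradient_squared P_def by (simp add: power2_eq_square)
  \<comment> \<open>The Hessian form evaluated at the gradient; as a double sum it may be summed in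
    either order.\<close>
  define c where "c = (\<Sum>k\<in>UNIV. P k * (\<Sum>i\<in>UNIV. P i * H i k))"
  \<comment> \<open>The first-order condition expresses the Hessian applied to the gradient by x -
    x0, and Cauchy-Schwarz with |x - x0| <= R leaves one factor 1/R.\<close>
  have c: "\<eta> * c \<le> real m * z * sqrt z / R"
  proof -
    have half: "\<eta> * a = (real m * z / R\<^sup>2) * d" if "\<eta> * (2 * a) = real m * (2 * d / R\<^sup>2) * z" for a d
      using that \<open>R > 0\<close> by (simp add: field_simps)
    have crit': "\<eta> * (\<Sum>i\<in>UNIV. P i * H i k) = (real m * z / R\<^sup>2) * (x - x0) $ k" for k
      by (rule half[OF crit])
    have "\<eta> * c = (\<Sum>k\<in>UNIV. P k * (\<eta> * (\<Sum>i\<in>UNIV. P i * H i k)))"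
      unfolding c_def by (subst sum_distrib_left) (simp add: mult.left_commute)
    also have "\<dots> = (real m * z / R\<^sup>2) * (\<Sum>k\<in>UNIV. P k * (x - x0) $ k)"
      unfolding crit' by (subst sum_distrib_left) (simp add: mult.left_commute)
    also have "(\<Sum>k\<in>UNIV. P k * (x - x0) $ k) = G \<bullet> (x - x0)"
      by (simp add: inner_vec_def G_def gradient_def P_def)
    also have "(real m * z / R\<^sup>2) * (G \<bullet> (x - x0)) \<le> (real m * z / R\<^sup>2) * (norm G * R)"
      using z norm_cauchy_schwarz[of G "x - x0"] mult_left_mono[OF nx norm_ge_zero, of G]
      by (intro mult_left_mono) auto
    also have "\<dots> = real m * z * sqrt z / R"
      using \<open>R > 0\<close> by (simp add: z_def power2_eq_square)
    finally show ?thesis .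
  qed
  have "(\<Sum>i\<in>UNIV. P i * (p * U powr (p - 1) * P i + M * (q / 2 * z powr (q / 2 - 1) * (2 * (\<Sum>k\<in>UNIV. P k * H i k)))))
     = p * U powr (p - 1) * z + M * q * z powr (q / 2 - 1) * c"
  proof -
    have c': "c = (\<Sum>i\<in>UNIV. P i * (\<Sum>k\<in>UNIV. P k * H i k))"
      unfolding c_def sum_distrib_left by (subst sum.swap) (simp add: mult_ac)
    have "P i * (p * U powr (p - 1) * P i + M * (q / 2 * z powr (q / 2 - 1) * (2 * a)))
        = p * U powr (p - 1) * (P i * P i) + M * q * z powr (q / 2 - 1) * (P i * a)" for i a
      by (simp add: algebra_simps)
    then show ?thesis
      unfolding c' by (simp only: sum.distrib sum_distrib_left[symmetric] zP[symmetric])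
  qed
  note main = main[unfolded this]
  have ypos: "y > 0" using z by (simp add: y_def)
  have y1: "z powr (q / 2 - 1) * (z * sqrt z) = y * z"
    unfolding y_def using z by (simp add: powr_half_sqrt[symmetric] powr_mult_base powr_add[symmetric] field_simps)
  have y2: "z powr q = y\<^sup>2 * z"
    unfolding y_def using z by (simp add: power2_eq_square powr_add[symmetric] powr_mult_base mult.commute)
  \<comment> \<open>The Hessian bound provides two copies of the cutoff squared times
    \<open>A\<close>: \<open>absorb\<close> spends one on the reaction term, the other
    remains.\<close>
  have "\<eta>\<^sup>2 * A \<le> 2 * ?N * M * q * real m * \<eta> * y * z / R + ?N * z * B / R\<^sup>2"
  proof -
    have "2 * \<eta>\<^sup>2 * A \<le> 2 * \<eta>\<^sup>2 * (?N * S)" using S by (intro mult_left_mono) auto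
    also have "\<dots> \<le> ?N * (2 * \<eta>\<^sup>2 * (p * U powr (p - 1) * z + M * q * z powr (q / 2 - 1) * c) + z * (B / R\<^sup>2))"
      using mult_left_mono[OF main, of ?N] by (simp add: algebra_simps)
    also have "\<dots> = \<eta>\<^sup>2 * (2 * ?N * p * U powr (p - 1) * z)
        + 2 * ?N * M * q * \<eta> * z powr (q / 2 - 1) * (\<eta> * c) + ?N * z * B / R\<^sup>2"
      by (simp add: algebra_simps power2_eq_square)
    also have "\<dots> \<le> \<eta>\<^sup>2 * A + 2 * ?N * M * q * \<eta> * z powr (q / 2 - 1) * (real m * z * sqrt z / R) + ?N * z * B / R\<^sup>2"
      using absorb c e pq \<open>M > 0\<close> by (intro add_mono mult_left_mono) auto
    also have "2 * ?N * M * q * \<eta> * z powr (q / 2 - 1) * (real m * z * sqrt z / R)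
        = 2 * ?N * M * q * real m * \<eta> / R * (z powr (q / 2 - 1) * (z * sqrt z))" by simp
    finally show ?thesis unfolding y1 by (simp add: mult.assoc mult.commute[of A])
  qed
  moreover have "\<eta>\<^sup>2 * (M\<^sup>2 * z powr q) \<le> \<eta>\<^sup>2 * A" unfolding A_def by (intro mult_left_mono) auto
  ultimately have "\<eta>\<^sup>2 * (M\<^sup>2 * (y\<^sup>2 * z)) \<le> 2 * ?N * M * q * real m * \<eta> * y * z / R + ?N * z * B / R\<^sup>2"
    unfolding y2 by linarith
  \<comment> \<open>After multiplication by R^2 / z this is quadratic in X, the cutoff times M y R,
    with coefficients free of \<open>R\<close>, \<open>M\<close> and \<open>z\<close>.\<close>
  then have "(\<eta>\<^sup>2 * (M\<^sup>2 * (y\<^sup>2 * z))) * (R\<^sup>2 / z)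
      \<le> (2 * ?N * M * q * real m * \<eta> * y * z / R + ?N * z * B / R\<^sup>2) * (R\<^sup>2 / z)"
    using z by (intro mult_right_mono) auto
  also have "\<dots> = (2 * ?N * q * real m) * (\<eta> * M * y * R) + ?N * B"
    using z \<open>R > 0\<close> by (simp add: field_simps power2_eq_square)
  also have "(\<eta>\<^sup>2 * (M\<^sup>2 * (y\<^sup>2 * z))) * (R\<^sup>2 / z) = (\<eta> * M * y * R)\<^sup>2"
    using z by (simp add: power_mult_distrib)
  finally have "(\<eta> * M * y * R)\<^sup>2 \<le> (2 * ?N * q * real m) * (\<eta> * M * y * R) + ?N * B" .
  then have X: "\<eta> * M * y * R \<le> 2 * ?N * q * real m + ?N * B + 1"
    using pq B by (intro quadratic_bound) auto
  have "v powr (q - 1) = (v\<^sup>2) powr ((q - 1) / 2)"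
    using norm_powr_square[of "gradient (\<lambda>y. u y t0) x0" "q - 1"] by (simp add: v_def)
  also have "\<dots> \<le> (\<eta> ^ m * z) powr ((q - 1) / 2)"
    using ge pq by (intro powr_mono2) auto
  also have "\<dots> = \<eta> powr (real m * (q - 1) / 2) * y"
    using e z by (simp add: y_def powr_mult powr_realpow[symmetric] powr_powr)
  \<comment> \<open>The cutoff lies in (0, 1] and the hypothesis \<open>m\<close> makes its exponent
    at least 1, so one full factor of the cutoff is gained, as needed for \<open>X\<close>.\<close>
  also have "\<dots> \<le> \<eta> powr 1 * y"
    using e m ypos by (intro mult_right_mono powr_mono') auto
  finally have "v powr (q - 1) \<le> \<eta> * y" using e by simp
  then have "M * v powr (q - 1) * R \<le> M * (\<eta> * y) * R"
    using \<open>M > 0\<close> \<open>R > 0\<close> by (intro mult_right_mono mult_left_mono) auto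
  with X show ?thesis by (simp add: v_def B_def mult_ac)
qed

theorem theorem1p2:
  fixes p q :: real
  assumes "p > 1" and "1 < q" and "q < 2 * p / (p + 1)"
  shows "\<exists>c>0. \<forall>M>0. \<forall>u :: real ^ 'n \<Rightarrow> real \<Rightarrow> real.
           nonneg_ancient_solution p q M u \<longrightarrow>
           (\<forall>x. \<forall>t<0. u x t \<le> c * M powr (2 / (2 * p - (p + 1) * q))) \<longrightarrow>
           (\<forall>x. \<forall>t<0. time_deriv u x t \<le> 0) \<longrightarrow>
           (\<forall>x. \<forall>t<0. u x t = 0)"
proof (intro exI[of _ "(2 * real CARD('n) * p) powr (- q / (2 * p - (p + 1) * q))"] conjI allI impI)
  \<comment> \<open>The witness is the threshold of \<open>reaction_absorption\<close> with the
    dimension as \<open>N\<close>.\<close>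
  show "(2 * real CARD('n) * p) powr (- q / (2 * p - (p + 1) * q)) > 0" using assms by simp
next
  fix M :: real and u :: "real ^ 'n \<Rightarrow> real \<Rightarrow> real" and x :: "real ^ 'n" and t :: real
  assume M: "M > 0" and sol: "nonneg_ancient_solution p q M u"
    and small: "\<forall>x. \<forall>t<0. u x t \<le> (2 * real CARD('n) * p) powr (- q / (2 * p - (p + 1) * q))
        * M powr (2 / (2 * p - (p + 1) * q))"
    and dec: "\<forall>x. \<forall>t<0. time_deriv u x t \<le> 0" and t: "t < 0"
  \<comment> \<open>The power of the cutoff depends on \<open>q\<close> alone and is fixed before
    \<open>R\<close> varies.\<close>
  obtain m :: nat where "real m \<ge> 2 / (q - 1)" using real_arch_simple by blast
  then have m: "real m * (q - 1) \<ge> 2" using assms by (simp add: field_simps)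
  have grad: "gradient (\<lambda>y. u y t) y = 0" for y
  proof (rule ccontr)
    assume "gradient (\<lambda>y. u y t) y \<noteq> 0"
    then have a: "M * norm (gradient (\<lambda>y. u y t) y) powr (q - 1) > 0" using M by simp
    obtain C where C: "\<And>R. R > 0 \<Longrightarrow> M * norm (gradient (\<lambda>y. u y t) y) powr (q - 1) * R \<le> C"
      using gradient_bound[OF sol assms M _ _ m t] dec small by blast
    obtain n :: nat where "C < real n * (M * norm (gradient (\<lambda>y. u y t) y) powr (q - 1))"
      using reals_Archimedean3[OF a] by blast
    \<comment> \<open>The radius n + 1 is positive even for n = 0 and makes the left-hand side
      exceed \<open>C\<close>.\<close>
    moreover have "M * norm (gradient (\<lambda>y. u y t) y) powr (q - 1) * (real n + 1) \<le> C" by (rule C) simp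
    ultimately show False using a by (simp add: algebra_simps)
  qed
  \<comment> \<open>The gradient vanishes on the whole time slice, hence so does the Laplacian, and
    the equation reduces to u_t = u^p; with u_t <= 0 this forces u = 0.\<close>
  have "partial_x i (\<lambda>y. u y t) = (\<lambda>y. 0)" for i
    using grad by (auto simp: gradient_def vec_eq_iff fun_eq_iff)
  then have "laplacian (\<lambda>y. u y t) x = 0" by (simp add: laplacian_def partial_x_def)
  moreover have "time_deriv u x t - laplacian (\<lambda>y. u y t) x
      = u x t powr p + M * norm (gradient (\<lambda>y. u y t) x) powr q"
    using sol t unfolding nonneg_ancient_solution_def by blast
  moreover have "time_deriv u x t \<le> 0" using dec t by blast
  ultimately show "u x t = 0" by (simp add: grad)
qed

end
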